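(* Let $G$ be a 2-dd in which every alternating cycle has exactly six arcs, let $C$ be its set of alternating cycles, and suppose that $G$ is odd. Then $G$ is non-Hamiltonian if and only if there is a nonempty proper subset $K\subset C$ such that $K$ is closed.
   Context: Digraphs are finite; arcs are ordered pairs $(u,v)$ of vertices ($u$ the start-vertex, $v$ the end-vertex); loops are allowed. For a vertex $v$, $v_{in}$ and $v_{out}$ are the sets of arcs with end-vertex $v$, respectively start-vertex $v$ (a loop belongs to both). A 2-digraph is a digraph in which every vertex $v$ satisfies $(|v_{in}|,|v_{out}|)\in\{(2,0),(0,2),(2,2)\}$; $v$ is called an exit, entry or saturated vertex respectively. A 2-dd is a 2-digraph all of whose vertices are saturated. A 2-dd is Hamiltonian if it has a directed cycle through all its vertices. An alternating cycle (AC) of a 2-digraph is a sequence $(e_0,\dots,e_{2r-1})$ of $2r$ distinct arcs such that, with indices mod $2r$, $e_i$ and $e_{i+1}$ have a common end-vertex if $i$ is even and a common start-vertex if $i$ is odd. The arcs of a 2-digraph $G$ are uniquely partitioned into ACs; $C$ denotes the set of ACs. For nonempty $K\subseteq C$, $G^K$ is the subgraph consisting of the arcs of the ACs in $K$ and their incident vertices; it is a 2-digraph. A factor $F$ of a 2-digraph is a spanning subgraph containing exactly one arc of $v_{in}$ for each vertex $v$ with $v_{in}\ne\emptyset$ and exactly one arc of $v_{out}$ for each $v$ with $v_{out}\neq\emptyset$; it is a disjoint union of simple cycles (a loop counts as a cycle) and simple paths from entry vertices to exit vertices. The index $i(F)$ is the number of cycles of $F$; $F$ is open if $i(F)=0$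 and closed otherwise. A 2-digraph is closed if all of its factors are closed, and open otherwise; $K$ is called closed (open) if $G^K$ is. A 2-dd is odd if $i(F)$ is odd for every factor $F$ of it. *)

theory Defs
  imports "Graph_Theory.Graph_Theory"
begin

text \<open>
  Digraphs are those of Graph_Theory whose arcs are pairs of vertices, so parallel arcs are
  excluded; the locale \<^locale>\<open>pair_fin_digraph\<close> is finite and allows loops.
\<close>

definition exit_vertex :: "'a pair_pre_digraph \<Rightarrow> 'a \<Rightarrow> bool" where
  "exit_vertex G v \<longleftrightarrow> v \<in> pverts G \<and> in_degree G v = 2 \<and> out_degree G v = 0"

definition entry_vertex :: "'a pair_pre_digraph \<Rightarrow> 'a \<Rightarrow> bool" where
  "entry_vertex G v \<longleftrightarrow> v \<in> pverts G \<and> in_degree G v = 0 \<and> out_degree G v = 2"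

definition saturated_vertex :: "'a pair_pre_digraph \<Rightarrow> 'a \<Rightarrow> bool" where
  "saturated_vertex G v \<longleftrightarrow> v \<in> pverts G \<and> in_degree G v = 2 \<and> out_degree G v = 2"

definition two_digraph :: "'a pair_pre_digraph \<Rightarrow> bool" where
  "two_digraph G \<longleftrightarrow> pair_fin_digraph G \<and>
     (\<forall>v \<in> pverts G. exit_vertex G v \<or> entry_vertex G v \<or> saturated_vertex G v)"

definition two_dd :: "'a pair_pre_digraph \<Rightarrow> bool" where
  "two_dd G \<longleftrightarrow> two_digraph G \<and> (\<forall>v \<in> pverts G. saturated_vertex G v)"

definition hamiltonian :: "'a pair_pre_digraph \<Rightarrow> bool" where
  "hamiltonian G \<longleftrightarrow>
     (\<exists>p. pre_digraph.cycle (with_proj G) p \<and> (\<forall>v \<in> pverts G. \<exists>e \<in> set p. fst e = v))"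

definition alternating_cycle :: "'a pair_pre_digraph \<Rightarrow> ('a \<times> 'a) list \<Rightarrow> bool" where
  "alternating_cycle G es \<longleftrightarrow>
     es \<noteq> [] \<and> even (length es) \<and> distinct es \<and> set es \<subseteq> parcs G \<and>
     (\<forall>i < length es.
        let e = es ! i; f = es ! ((i + 1) mod length es)
        in if even i then snd e = snd f else fst e = fst f)"

text \<open>
  The sequences describing one alternating cycle differ only in starting point and direction,
  so an alternating cycle is identified with its set of arcs; in a 2-digraph these sets
  partition the arcs.
\<close>

definition ACs :: "'a pair_pre_digraph \<Rightarrow> ('a \<times> 'a) set set" where
  "ACs G = {set es | es. alternating_cycle G es}"

text \<open>The subgraph \<open>G\<^sup>K\<close>, which depends on \<open>G\<close> only through \<open>K \<subseteq> ACs G\<close>.\<close>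

definition AC_subgraph :: "('a \<times> 'a) set set \<Rightarrow> 'a pair_pre_digraph" where
  "AC_subgraph K = \<lparr> pverts = fst ` (\<Union>K) \<union> snd ` (\<Union>K), parcs = \<Union>K \<rparr>"

definition is_factor :: "'a pair_pre_digraph \<Rightarrow> 'a pair_pre_digraph \<Rightarrow> bool" where
  "is_factor G F \<longleftrightarrow> spanning (with_proj F) (with_proj G) \<and>
     (\<forall>v \<in> pverts G.
        (in_arcs G v \<noteq> {} \<longrightarrow> card (in_arcs G v \<inter> parcs F) = 1) \<and>
        (out_arcs G v \<noteq> {} \<longrightarrow> card (out_arcs G v \<inter> parcs F) = 1))"

text \<open>
  The cycles of a factor are pairwise disjoint, so each is determined by its set of arcs;
  passing to that set identifies the rotations of a cyclic arc sequence.
  A loop \<open>(v, v)\<close> gives the cycle \<open>[(v, v)]\<close>.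
\<close>

definition index :: "'a pair_pre_digraph \<Rightarrow> nat" where
  "index F = card {set p | p. pre_digraph.cycle (with_proj F) p}"

definition open_factor :: "'a pair_pre_digraph \<Rightarrow> bool" where
  "open_factor F \<longleftrightarrow> index F = 0"

definition closed_digraph :: "'a pair_pre_digraph \<Rightarrow> bool" where
  "closed_digraph G \<longleftrightarrow> (\<forall>F. is_factor G F \<longrightarrow> \<not> open_factor F)"

definition closed_AC_set :: "('a \<times> 'a) set set \<Rightarrow> bool" where
  "closed_AC_set K \<longleftrightarrow> closed_digraph (AC_subgraph K)"

definition odd_digraph :: "'a pair_pre_digraph \<Rightarrow> bool" where
  "odd_digraph G \<longleftrightarrow> (\<forall>F. is_factor G F \<longrightarrow> odd (index F))"

end

theory Submission
  imports Defs
begin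

text \<open>
  A factor of a 2-dd is a permutation of the vertices, and its index is the number of orbits.
  If \<open>K\<close> is closed, a Hamiltonian cycle restricted to \<open>G\<^sup>K\<close> is a factor and thus
  contains a cycle, which must be the whole Hamiltonian cycle; since the latter has arcs in every
  alternating cycle, \<open>K = C\<close>. Conversely, remove a single alternating cycle \<open>A\<close>. An open
  factor of the rest consists of paths joining the three end-vertices of \<open>A\<close> to its three
  start-vertices, and either of the two perfect matchings contained in \<open>A\<close> completes it to a
  factor of \<open>G\<close> with at most three cycles. By oddness the first matching gives one cycle or three.
  In the latter case each path closes up with one arc of the matching, and switching to the other
  matching, which amounts to multiplying by a three-cycle, merges the three cycles into one.
\<close>

section \<open>Cycles of a functional digraph\<close>

text \<open>When every arc has the form \<open>(w, f w)\<close>, a walk has no choice after its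
  first vertex and runs through the iterates of \<open>f\<close>.\<close>

lemma pcas_funpow:
  assumes "pcas u p v" "\<forall>e \<in> set p. snd e = f (fst e)"
  shows "fst ` set p = {(f ^^ i) u | i. i < length p}" "v = (f ^^ length p) u"
  using assms
proof (induction p arbitrary: u)
  case Nil
  { case 1 show ?case by simp next case 2 then show ?case by simp }
next
  case (Cons e p)
  have *: "{(f ^^ i) u | i. i < Suc n} = insert u {(f ^^ i) (f u) | i. i < n}" for n u
  proof -
    have "{(f ^^ i) u | i. i < Suc n} = (\<lambda>i. (f ^^ i) u) ` {..<Suc n}" by auto
    also have "\<dots> = insert u ((\<lambda>i. (f ^^ Suc i) u) ` {..<n})"
      by (simp only: lessThan_Suc_eq_insert_0 image_insert image_image) simp
    also have "\<dots> = insert u {(f ^^ i) (f u) | i. i < n}"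
      by (auto simp: funpow_swap1)
    finally show ?thesis .
  qed
  { case 1
    then have "fst e = u" "snd e = f u" by auto
    moreover have "fst ` set p = {(f ^^ i) (f u) | i. i < length p}"
      using Cons.IH(1)[of "f u"] 1 by auto
    ultimately show ?case by (simp add: *)
  next
    case 2
    then show ?case using Cons.IH(2)[of "f u"] by (auto simp: funpow_swap1) }
qed

text \<open>After the starting vertex, the vertices of a walk are the heads of its arcs, so the
  vertex condition on cycles turns into distinctness of \<open>map snd p\<close>.\<close>

lemma cycle_with_proj_iff:
  "pre_digraph.cycle (with_proj F) p \<longleftrightarrow>
     (\<exists>u \<in> pverts F. set p \<subseteq> parcs F \<and> pcas u p u \<and> distinct (map snd p) \<and> p \<noteq> [])"
proof -
  have "tl (pawalk_verts u p) = map snd p" if "pcas u p u" for u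
    using pre_digraph.awalk_verts_conv'[of "with_proj F" u p u] that
    by (auto simp: cas_with_proj_eq awalk_verts_with_proj_eq)
  then show ?thesis
    unfolding pre_digraph.cycle_def pre_digraph.awalk_def cas_with_proj_eq
      awalk_verts_with_proj_eq with_proj_simps by auto
qed

text \<open>A closed walk returns to \<open>u\<close> after \<open>length p > 0\<close> steps, so
  \<open>u\<close> lies on its own orbit and the tails exhaust that orbit.\<close>

lemma cycle_cyclic_on:
  assumes "pre_digraph.cycle (with_proj F) p" "\<forall>e \<in> set p. snd e = f (fst e)"
  shows "cyclic_on f (fst ` set p)"
proof -
  obtain u where u: "pcas u p u" "p \<noteq> []"
    using assms(1) by (auto simp: cycle_with_proj_iff)
  have n: "(f ^^ length p) u = u" "0 < length p"
    using pcas_funpow(2)[OF u(1) assms(2)] u(2) by simp_all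
  then have "u \<in> orbit f u" unfolding orbit_altdef by (metis (mono_tags, lifting) mem_Collect_eq)
  then show ?thesis
    unfolding cyclic_on_def pcas_funpow(1)[OF u(1) assms(2)] orbit_altdef_bounded[OF n, symmetric]
    by blast
qed

lemma orbit_cycle:
  assumes "v \<in> orbit f v" "v \<in> pverts F" "(\<lambda>u. (u, f u)) ` orbit f v \<subseteq> parcs F"
  shows "\<exists>p. pre_digraph.cycle (with_proj F) p \<and> set p = (\<lambda>u. (u, f u)) ` orbit f v"
proof -
  \<comment> \<open>The first return time of \<open>v\<close>: the iterates with exponents below
    \<open>n\<close> are distinct and fill the orbit.\<close>
  define n where "n = funpow_dist1 f v v"
  define p where "p = map (\<lambda>i. ((f ^^ i) v, (f ^^ Suc i) v)) [0..<n]"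
  have n: "0 < n" "(f ^^ n) v = v"
    using funpow_dist1_prop[OF assms(1)] by (auto simp: n_def)
  have set_p: "set p = (\<lambda>u. (u, f u)) ` orbit f v"
    unfolding orbit_conv_funpow_dist1[OF assms(1)] n_def[symmetric] p_def by auto
  \<comment> \<open>The start index \<open>j\<close> is left general because each induction step
    removes the first arc.\<close>
  have "pcas ((f ^^ j) v) (map (\<lambda>i. ((f ^^ i) v, (f ^^ Suc i) v)) [j..<j + m]) ((f ^^ (j + m)) v)"
    for j m
  proof (induction m arbitrary: j)
    case (Suc m)
    have "[j..<j + Suc m] = j # [Suc j..<Suc j + m]" by (simp add: upt_conv_Cons del: upt_Suc)
    then show ?case using Suc.IH[of "Suc j"] by simp
  qed simp
  from this[of 0 n] have "pcas v p v" using n by (simp add: p_def)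
  moreover have "distinct (map snd p)"
  proof -
    have inj: "i = j" if "(f ^^ i) v = (f ^^ j) v" "i < n" "j < n" for i j
      using inj_onD[OF inj_on_funpow_dist1[OF assms(1), folded n_def] that(1)] that(2,3) by simp
    \<comment> \<open>The heads are iterates 1 to \<open>n\<close>, whereas injectivity is known for
      0 to \<open>n - 1\<close>; exponent \<open>n\<close> is therefore traded for 0.\<close>
    have "i = j" if eq: "(f ^^ Suc i) v = (f ^^ Suc j) v" and lt: "i < n" "j < n" for i j
    proof -
      consider "Suc i < n" "Suc j < n" | "Suc i = n" "Suc j < n" | "Suc i < n" "Suc j = n"
        | "Suc i = n" "Suc j = n"
        using Suc_leI[OF lt(1)] Suc_leI[OF lt(2)] unfolding le_less by blast
      then show ?thesis
        by cases (use inj[of "Suc i" "Suc j"] inj[of 0 "Suc j"] inj[of "Suc i" 0] n eq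
          in \<open>auto simp del: funpow.simps(2)\<close>)
    qed
    then have "inj_on (\<lambda>i. (f ^^ Suc i) v) {0..<n}" by (auto simp: inj_on_def)
    then show ?thesis by (simp add: p_def distinct_map comp_def)
  qed
  moreover have "p \<noteq> []" using n by (simp add: p_def)
  ultimately show ?thesis
    unfolding cycle_with_proj_iff using assms(2,3) set_p by (intro exI[of _ p]) auto
qed

text \<open>Under a permutation of a finite set every vertex lies on its own orbit. Cycles of
  \<open>F\<close> thus correspond to orbits of \<open>f\<close>, by the injective passage from a
  vertex set to the graph of \<open>f\<close> over it.\<close>

lemma index_functional:
  assumes "f permutes pverts F" "finite (pverts F)" "parcs F = (\<lambda>v. (v, f v)) ` pverts F"
  shows "index F = card (orbit f ` pverts F)"
proof -
  have per: "permutation f" using assms by (auto simp: permutation_permutes)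
  have "{set p | p. pre_digraph.cycle (with_proj F) p}
      = (\<lambda>S. (\<lambda>u. (u, f u)) ` S) ` orbit f ` pverts F" (is "?L = ?R")
  proof
    show "?L \<subseteq> ?R"
    proof
      fix X assume "X \<in> ?L"
      then obtain p where p: "X = set p" "pre_digraph.cycle (with_proj F) p" by auto
      have sub: "set p \<subseteq> parcs F" "p \<noteq> []" using p(2) by (auto simp: cycle_with_proj_iff)
      then have f: "\<forall>e \<in> set p. snd e = f (fst e)" using assms(3) by auto
      obtain v where v: "v \<in> fst ` set p" "fst ` set p = orbit f v"
        using cycle_cyclic_on[OF p(2) f] by (auto simp: cyclic_on_def)
      have "X = (\<lambda>u. (u, f u)) ` (fst ` set p)"
        using f p(1) by (force simp: image_iff)
      moreover have "v \<in> pverts F" using v(1) sub assms(3) by auto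
      ultimately show "X \<in> ?R" using v(2) by auto
    qed
    show "?R \<subseteq> ?L"
    proof
      fix X assume "X \<in> ?R"
      then obtain v where v: "v \<in> pverts F" "X = (\<lambda>u. (u, f u)) ` orbit f v" by auto
      have "X \<subseteq> parcs F"
        using v permutes_orbit_subset[OF assms(1) v(1)] assms(3) by auto
      then show "X \<in> ?L"
        using orbit_cycle[OF permutation_self_in_orbit[OF per] v(1)] v(2) by force
    qed
  qed
  moreover have "inj (\<lambda>S. (\<lambda>u. (u, f u)) ` S)"
  proof -
    have "inj (\<lambda>u. (u, f u))" by (simp add: inj_def)
    then show ?thesis by (intro injI) (simp add: inj_image_eq_iff)
  qed
  ultimately show ?thesis
    unfolding index_def by (simp add: card_image inj_on_subset)
qed

section \<open>Factors as bijections\<close>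

text \<open>Meant for \<open>h\<close> equal to \<open>fst\<close> or \<open>snd\<close> and
  \<open>U\<close> the arcs of a digraph: one factor arc per nonempty fibre becomes a bijection,
  which is easy to restrict and to glue.\<close>

lemma bij_betw_iff_card_fibre:
  assumes "E \<subseteq> U"
  shows "bij_betw h E (h ` U) \<longleftrightarrow> (\<forall>v \<in> h ` U. card {e \<in> E. h e = v} = 1)"
proof
  assume b: "bij_betw h E (h ` U)"
  show "\<forall>v \<in> h ` U. card {e \<in> E. h e = v} = 1"
  proof
    fix v assume "v \<in> h ` U"
    then have "v \<in> h ` E" using b by (simp add: bij_betw_def)
    then obtain e where "e \<in> E" "h e = v" by blast
    then have "{e \<in> E. h e = v} = {e}" using b by (auto simp: bij_betw_def inj_on_def)
    then show "card {e \<in> E. h e = v} = 1" by simp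
  qed
next
  assume c: "\<forall>v \<in> h ` U. card {e \<in> E. h e = v} = 1"
  have fibre: "\<exists>x. {e \<in> E. h e = v} = {x}" if "v \<in> h ` U" for v
    using bspec[OF c that] by (rule card_1_singletonE) blast
  have "inj_on h E"
  proof (rule inj_onI)
    fix d e assume de: "d \<in> E" "e \<in> E" "h d = h e"
    then have "h e \<in> h ` U" using assms by blast
    then obtain x where "{e' \<in> E. h e' = h e} = {x}" using fibre by blast
    then show "d = e" using de by (metis (mono_tags, lifting) mem_Collect_eq singletonD)
  qed
  moreover have "h ` U \<subseteq> h ` E"
  proof
    fix v assume "v \<in> h ` U"
    then obtain x where "{e \<in> E. h e = v} = {x}" using fibre by blast
    then have "x \<in> {e \<in> E. h e = v}" by simp
    then show "v \<in> h ` E" by blast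
  qed
  ultimately show "bij_betw h E (h ` U)"
    using image_mono[OF assms, of h] unfolding bij_betw_def by (simp add: subset_antisym)
qed

text \<open>Vertices without outgoing (incoming) arcs are those outside the image of
  \<open>fst\<close> (\<open>snd\<close>), so the side conditions of \<open>is_factor\<close> turn
  into the choice of codomain.\<close>

lemma is_factor_iff_bij_betw:
  assumes "pair_wf_digraph H"
  shows "is_factor H F \<longleftrightarrow> pverts F = pverts H \<and> parcs F \<subseteq> parcs H \<and>
    bij_betw fst (parcs F) (fst ` parcs H) \<and> bij_betw snd (parcs F) (snd ` parcs H)"
proof -
  interpret H: pair_wf_digraph H by fact
  have sp: "spanning (with_proj F) (with_proj H) \<longleftrightarrow> pverts F = pverts H \<and> parcs F \<subseteq> parcs H"
  proof -
    have "pair_wf_digraph F" if "pverts F = pverts H" "parcs F \<subseteq> parcs H"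
      using that H.arc_fst_in_verts H.arc_snd_in_verts unfolding pair_wf_digraph_def by blast
    then show ?thesis
      using assms unfolding spanning_def subgraph_def compatible_def
      by (auto simp: wf_digraph_wp_iff)
  qed
  have "is_factor H F \<longleftrightarrow> pverts F = pverts H \<and> parcs F \<subseteq> parcs H \<and>
    (\<forall>v \<in> fst ` parcs H. card {e \<in> parcs F. fst e = v} = 1) \<and>
    (\<forall>v \<in> snd ` parcs H. card {e \<in> parcs F. snd e = v} = 1)"
  proof (cases "pverts F = pverts H \<and> parcs F \<subseteq> parcs H")
    case True
    have "out_arcs (with_proj H) v \<inter> parcs F = {e \<in> parcs F. fst e = v}"
      "in_arcs (with_proj H) v \<inter> parcs F = {e \<in> parcs F. snd e = v}" for v
      using True by (auto simp: in_arcs_def out_arcs_def)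
    moreover have "out_arcs (with_proj H) v \<noteq> {} \<longleftrightarrow> v \<in> fst ` parcs H"
      "in_arcs (with_proj H) v \<noteq> {} \<longleftrightarrow> v \<in> snd ` parcs H" for v
      by (force simp: in_arcs_def out_arcs_def)+
    ultimately have "is_factor H F \<longleftrightarrow> (\<forall>v \<in> pverts H.
        (v \<in> snd ` parcs H \<longrightarrow> card {e \<in> parcs F. snd e = v} = 1) \<and>
        (v \<in> fst ` parcs H \<longrightarrow> card {e \<in> parcs F. fst e = v} = 1))"
      unfolding is_factor_def sp using True by simp
    moreover have "v \<in> pverts H" if "v \<in> fst ` parcs H \<or> v \<in> snd ` parcs H" for v
      using that H.arc_fst_in_verts H.arc_snd_in_verts by blast
    ultimately show ?thesis using True by meson
  qed (auto simp: is_factor_def sp)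
  then show ?thesis
    using bij_betw_iff_card_fibre[of "parcs F" "parcs H"] by auto
qed

text \<open>The inverse of \<open>fst\<close> on \<open>E\<close> followed by \<open>snd\<close> is
  the successor map; \<open>permutes\<close> asks for its extension by the identity outside
  \<open>V\<close>.\<close>

lemma bij_betw_permutes:
  assumes "bij_betw fst E V" "bij_betw snd E V"
  obtains f where "f permutes V" "E = (\<lambda>v. (v, f v)) ` V"
proof -
  define g where "g = snd \<circ> inv_into E fst"
  define f where "f v = (if v \<in> V then g v else v)" for v
  have "bij_betw g V V"
    unfolding g_def using bij_betw_trans[OF bij_betw_inv_into[OF assms(1)] assms(2)] .
  then have "bij_betw f V V" by (rule bij_betw_cong[THEN iffD1, rotated]) (simp add: f_def)
  then have "f permutes V" by (rule bij_imp_permutes) (simp add: f_def)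
  moreover have "E = (\<lambda>v. (v, f v)) ` V"
  proof -
    have *: "e = (fst e, f (fst e))" "fst e \<in> V" if "e \<in> E" for e
      using that assms(1) by (auto simp: f_def g_def bij_betw_def)
    moreover have "\<exists>e \<in> E. fst e = v" if "v \<in> V" for v
      using that assms(1) by (force simp: bij_betw_def)
    ultimately show ?thesis by (force simp: image_iff)
  qed
  ultimately show ?thesis using that by blast
qed

section \<open>Alternating cycles\<close>

text \<open>In a 2-digraph these sets are exactly the unions of alternating cycles. This closure
  property expresses the partition of the arcs without arithmetic on positions.\<close>

definition alternation_stable :: "'a pair_pre_digraph \<Rightarrow> ('a \<times> 'a) set \<Rightarrow> bool" where
  "alternation_stable G B \<longleftrightarrow> B \<subseteq> parcs G \<and>
     (\<forall>e \<in> B. \<forall>e' \<in> parcs G. fst e' = fst e \<or> snd e' = snd e \<longrightarrow> e' \<in> B)"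

lemma alternation_stableD:
  assumes "alternation_stable G B" "e \<in> B" "e' \<in> parcs G" "fst e' = fst e \<or> snd e' = snd e"
  shows "e' \<in> B"
  using assms unfolding alternation_stable_def by blast

lemma alternation_stable_subset: "alternation_stable G B \<Longrightarrow> B \<subseteq> parcs G"
  by (simp add: alternation_stable_def)

text \<open>All degrees are 0 or 2, and \<open>e\<close> itself rules out 0.\<close>

lemma two_digraph_fibres:
  assumes "two_digraph G" "e \<in> parcs G"
  shows "card {e' \<in> parcs G. fst e' = fst e} = 2" "card {e' \<in> parcs G. snd e' = snd e} = 2"
proof -
  interpret pair_fin_digraph G using assms(1) by (simp add: two_digraph_def)
  have eq: "out_degree (with_proj G) v = card {e' \<in> parcs G. fst e' = v}"
    "in_degree (with_proj G) v = card {e' \<in> parcs G. snd e' = v}" for v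
    by (simp_all add: out_degree_def in_degree_def out_arcs_def in_arcs_def)
  have fin: "finite {e' \<in> parcs G. P e'}" for P using pair_finite_arcs by simp
  have "fst e \<in> pverts G" "snd e \<in> pverts G"
    using assms(2) arc_fst_in_verts arc_snd_in_verts by auto
  then have "card {e' \<in> parcs G. fst e' = fst e} \<in> {0, 2}" "card {e' \<in> parcs G. snd e' = snd e} \<in> {0, 2}"
    using assms(1)
    unfolding two_digraph_def exit_vertex_def entry_vertex_def saturated_vertex_def eq
    by auto
  moreover have "card {e' \<in> parcs G. fst e' = fst e} \<noteq> 0" "card {e' \<in> parcs G. snd e' = snd e} \<noteq> 0"
    using assms(2) fin by (simp_all add: card_eq_0_iff) (metis surjective_pairing)+
  ultimately show "card {e' \<in> parcs G. fst e' = fst e} = 2" "card {e' \<in> parcs G. snd e' = snd e} = 2"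
    by auto
qed

lemma card_2_mem:
  assumes "card X = 2" "a \<in> X" "b \<in> X" "a \<noteq> b" "c \<in> X"
  shows "c = a \<or> c = b"
  using assms by (auto simp: card_2_iff)

lemma partner_unique:
  assumes "two_digraph G" "e \<in> parcs G" "e1 \<in> parcs G" "e2 \<in> parcs G" "e1 \<noteq> e" "e2 \<noteq> e"
    and "fst e1 = fst e \<and> fst e2 = fst e \<or> snd e1 = snd e \<and> snd e2 = snd e"
  shows "e1 = e2"
  using assms(7)
proof
  assume "fst e1 = fst e \<and> fst e2 = fst e"
  then show ?thesis
    using card_2_mem[OF two_digraph_fibres(1)[OF assms(1,2)], of e e1 e2] assms by auto
next
  assume "snd e1 = snd e \<and> snd e2 = snd e"
  then show ?thesis
    using card_2_mem[OF two_digraph_fibres(2)[OF assms(1,2)], of e e1 e2] assms by auto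
qed

text \<open>Since the length is even, an even position is never the last one; the wrap-around
  concerns odd positions only.\<close>

lemma alternating_cycle_nth:
  assumes "alternating_cycle G es" "i < length es"
  shows "even i \<Longrightarrow> Suc i < length es \<and> snd (es ! i) = snd (es ! Suc i)"
    and "odd i \<Longrightarrow> fst (es ! i) = fst (es ! (Suc i mod length es))"
proof -
  have ev: "even (length es)" using assms(1) by (simp add: alternating_cycle_def)
  have *: "if even i then snd (es ! i) = snd (es ! (Suc i mod length es))
      else fst (es ! i) = fst (es ! (Suc i mod length es))"
    using assms unfolding alternating_cycle_def Let_def by auto
  { assume "even i"
    then have "Suc i < length es" using assms(2) ev by (metis Suc_lessI even_Suc)
    then show "Suc i < length es \<and> snd (es ! i) = snd (es ! Suc i)"
      using * \<open>even i\<close> by auto }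
  { assume "odd i" then show "fst (es ! i) = fst (es ! (Suc i mod length es))" using * by auto }
qed

text \<open>Each arc of the sequence has a neighbour with the same head and one with the same tail,
  and the degree condition leaves no further arc at that head or tail.\<close>

lemma AC_stable:
  assumes G: "two_digraph G" and "A \<in> ACs G"
  shows "alternation_stable G A"
proof -
  obtain es where A: "A = set es" and ac: "alternating_cycle G es"
    using assms(2) by (auto simp: ACs_def)
  have es: "es \<noteq> []" "even (length es)" "distinct es" "set es \<subseteq> parcs G"
    using ac by (auto simp: alternating_cycle_def)
  note nth = alternating_cycle_nth[OF ac]
  have mem: "es ! k \<in> A \<and> es ! k \<noteq> es ! i" if "i < length es" "k < length es" "k \<noteq> i" for i k
    using that es(3) A by (simp add: nth_eq_iff_index_eq)
  have snd_partner: "\<exists>e' \<in> A. e' \<noteq> e \<and> snd e' = snd e" if "e \<in> A" for e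
  proof -
    have "e \<in> set es" using that A by simp
    then obtain i where i: "i < length es" "e = es ! i"
      unfolding in_set_conv_nth by blast
    show ?thesis
    proof (cases "even i")
      case True
      then show ?thesis
        using nth(1)[OF i(1)] mem[OF i(1), of "Suc i"] i(2) by (intro bexI[of _ "es ! Suc i"]) simp_all
    next
      case False
      then obtain j where "i = Suc j" "even j" by (cases i) auto
      then show ?thesis
        using nth(1)[of j] mem[OF i(1), of j] i by (intro bexI[of _ "es ! j"]) simp_all
    qed
  qed
  have fst_partner: "\<exists>e' \<in> A. e' \<noteq> e \<and> fst e' = fst e" if "e \<in> A" for e
  proof -
    have "e \<in> set es" using that A by simp
    then obtain i where i: "i < length es" "e = es ! i"
      unfolding in_set_conv_nth by blast
    \<comment> \<open>Arcs with a common tail sit at positions \<open>i\<close> and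
      \<open>i + 1\<close> for odd \<open>i\<close>, and at the last position and 0.\<close>
    consider "odd i" "Suc i < length es" | "odd i" "Suc i = length es" | "i = 0"
      | j where "i = Suc j" "odd j"
      using i(1) by (metis Suc_lessI even_Suc not0_implies_Suc)
    then show ?thesis
    proof cases
      case 1
      then show ?thesis
        using nth(2)[OF i(1)] mem[OF i(1), of "Suc i"] i(2) by (intro bexI[of _ "es ! Suc i"]) simp_all
    next
      case 2
      then have "0 < i" by (cases i) simp_all
      then show ?thesis
        using 2 nth(2)[OF i(1)] mem[OF i(1), of 0] i es(1) by (intro bexI[of _ "es ! 0"]) simp_all
    next
      case 3
      have "length es - 1 < length es" "odd (length es - 1)" "Suc (length es - 1) = length es"
        using es(1,2) by auto
      moreover have "length es - 1 \<noteq> 0" using \<open>odd (length es - 1)\<close> by (metis even_zero)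
      ultimately show ?thesis
        using nth(2)[of "length es - 1"] mem[OF i(1), of "length es - 1"] 3 i(2)
        by (intro bexI[of _ "es ! (length es - 1)"]) simp_all
    next
      case 4
      then show ?thesis
        using nth(2)[of j] mem[OF i(1), of j] i by (intro bexI[of _ "es ! j"]) simp_all
    qed
  qed
  show ?thesis unfolding alternation_stable_def
  proof (intro conjI ballI impI)
    show "A \<subseteq> parcs G" using A es(4) by simp
    fix e e' assume e: "e \<in> A" "e' \<in> parcs G" and or: "fst e' = fst e \<or> snd e' = snd e"
    obtain e1 e2 where p: "e1 \<in> A" "e1 \<noteq> e" "fst e1 = fst e" "e2 \<in> A" "e2 \<noteq> e" "snd e2 = snd e"
      using fst_partner[OF e(1)] snd_partner[OF e(1)] by blast
    show "e' \<in> A"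
      using partner_unique[OF G, of e e' e1] partner_unique[OF G, of e e' e2] or p e \<open>A \<subseteq> parcs G\<close>
      by auto
  qed
qed

text \<open>Consecutive arcs share a head or a tail, so stability carries membership in
  \<open>B\<close> around the sequence, starting at a common arc.\<close>

lemma AC_minimal:
  assumes "A \<in> ACs G" "alternation_stable G B" "A \<inter> B \<noteq> {}"
  shows "A \<subseteq> B"
proof -
  obtain es where A: "A = set es" and ac: "alternating_cycle G es"
    using assms(1) by (auto simp: ACs_def)
  let ?n = "length es"
  have es: "es \<noteq> []" "set es \<subseteq> parcs G"
    using ac by (auto simp: alternating_cycle_def)
  have step: "es ! (Suc i mod ?n) \<in> B" if "es ! i \<in> B" "i < ?n" for i
  proof -
    have "es ! (Suc i mod ?n) \<in> parcs G" using es by (auto intro!: subsetD[OF es(2)])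
    moreover have "fst (es ! (Suc i mod ?n)) = fst (es ! i) \<or> snd (es ! (Suc i mod ?n)) = snd (es ! i)"
      using alternating_cycle_nth[OF ac that(2)] by (cases "even i") auto
    ultimately show ?thesis by (rule alternation_stableD[OF assms(2) that(1)])
  qed
  obtain d where "d \<in> set es" "d \<in> B" using assms(3) A by blast
  then obtain j where j: "j < ?n" "es ! j \<in> B" unfolding in_set_conv_nth by blast
  have iter: "es ! ((j + k) mod ?n) \<in> B" for k
  proof (induction k)
    case (Suc k)
    then show ?case using step[of "(j + k) mod ?n"] es(1) by (simp add: mod_Suc_eq)
  qed (use j in simp)
  show ?thesis
  proof
    fix e assume "e \<in> A"
    then obtain i where i: "i < ?n" "e = es ! i" unfolding A in_set_conv_nth by blast
    \<comment> \<open>Position \<open>i\<close> is reached from \<open>j\<close> by running past the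
      end of the list once, whether or not \<open>i < j\<close>.\<close>
    have "(j + (?n - j + i)) mod ?n = i" using i j by simp
    then show "e \<in> B" using iter[of "?n - j + i"] i(2) by simp
  qed
qed

lemma AC_disjoint:
  assumes "two_digraph G" "A \<in> ACs G" "B \<in> ACs G" "A \<inter> B \<noteq> {}"
  shows "A = B"
  using AC_minimal[OF assms(2) AC_stable[OF assms(1,3)]]
    AC_minimal[OF assms(3) AC_stable[OF assms(1,2)]] assms(4) by (simp add: Int_commute subset_antisym)

lemma AC_Union_stable:
  assumes "two_digraph G" "K \<subseteq> ACs G"
  shows "alternation_stable G (\<Union>K)"
proof -
  have "alternation_stable G A" if "A \<in> K" for A using AC_stable assms that by blast
  then show ?thesis unfolding alternation_stable_def by blast
qed

text \<open>
  Walk alternately to the other arc with the same end-vertex and the other arc with the same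
  start-vertex: the first arc to be repeated can only be the initial one.
\<close>

lemma AC_cover:
  assumes G: "two_digraph G" and e: "e \<in> parcs G"
  obtains A where "A \<in> ACs G" "e \<in> A"
proof -
  have other: "\<exists>e' \<in> X. e' \<noteq> d" if "card X = 2" for X :: "('a \<times> 'a) set" and d
    using that by (auto simp: card_2_iff)
  have ex1: "\<exists>e'. e' \<in> parcs G \<and> e' \<noteq> d \<and> fst e' = fst d"
    and ex2: "\<exists>e'. e' \<in> parcs G \<and> e' \<noteq> d \<and> snd e' = snd d" if "d \<in> parcs G" for d
    using other[OF two_digraph_fibres(1)[OF G that], of d]
      other[OF two_digraph_fibres(2)[OF G that], of d] by auto
  \<comment> \<open>\<open>t\<close> and \<open>h\<close> pick the other arc with the same tail and
    with the same head; degree two makes both involutions.\<close>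
  obtain t where t: "\<And>d. d \<in> parcs G \<Longrightarrow> t d \<in> parcs G \<and> t d \<noteq> d \<and> fst (t d) = fst d"
    using ex1 by metis
  obtain h where h: "\<And>d. d \<in> parcs G \<Longrightarrow> h d \<in> parcs G \<and> h d \<noteq> d \<and> snd (h d) = snd d"
    using ex2 by metis
  have tt: "t (t d) = d" if "d \<in> parcs G" for d
    using partner_unique[OF G, of "t d" "t (t d)" d] t[OF that] t[of "t d"] that by metis
  have hh: "h (h d) = d" if "d \<in> parcs G" for d
    using partner_unique[OF G, of "h d" "h (h d)" d] h[OF that] h[of "h d"] that by metis
  \<comment> \<open>\<open>h\<close> is applied at even and \<open>t\<close> at odd positions,
    matching the parity convention of \<open>alternating_cycle\<close>.\<close>
  define s where "s = rec_nat e (\<lambda>n d. if even n then h d else t d)"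
  have s0: "s 0 = e" and sS: "s (Suc n) = (if even n then h (s n) else t (s n))" for n
    by (simp_all add: s_def)
  have sG: "s n \<in> parcs G" for n
    by (induction n) (auto simp: s0 sS e t h)
  have sback: "s n = (if even n then h (s (Suc n)) else t (s (Suc n)))" for n
    using tt[OF sG] hh[OF sG] by (simp add: sS)
  have sne: "s (Suc n) \<noteq> s n" for n using t[OF sG] h[OF sG] by (simp add: sS)
  have "\<not> inj s"
  proof
    assume "inj s"
    moreover have "finite (range s)"
      using sG G by (auto simp: two_digraph_def pair_fin_digraph_def pair_fin_digraph_axioms_def
        intro: finite_subset)
    ultimately show False using finite_imageD by blast
  qed
  then obtain i j where "i < j" "s i = s j" by (metis injI linorder_neqE_nat)
  then have "\<exists>n. \<exists>j<n. s j = s n" by blast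
  \<comment> \<open>The first index whose arc has occurred before; the arcs preceding it are
    distinct.\<close>
  define n where "n = (LEAST n. \<exists>j<n. s j = s n)"
  have n: "\<exists>j<n. s j = s n"
    unfolding n_def by (rule LeastI_ex) fact
  have dist: "s i \<noteq> s j" if "i < j" "j < n" for i j
    using not_less_Least[of j "\<lambda>n. \<exists>j<n. s j = s n"] that by (auto simp: n_def)
  then have inj: "i = j" if "s i = s j" "i < n" "j < n" for i j
    using that by (metis linorder_neqE_nat)
  obtain j where j: "j < n" "s j = s n" using n by blast
  obtain m where m: "n = Suc m" using j(1) by (cases n) auto
  \<comment> \<open>With equal parities, stepping back from \<open>n\<close> and forward from
    \<open>j\<close> applies the same involution to the same arc, so \<open>s m = s (Suc j)\<close>.
    Minimality of \<open>n\<close> forces \<open>m = Suc j\<close>, against equal parity.\<close>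
  have parity: "even m = odd j"
  proof (rule ccontr)
    assume "even m \<noteq> odd j"
    then have "even m = even j" by auto
    then have "s m = s (Suc j)" using sback[of m] sS[of j] j(2) m by auto
    moreover have "Suc j \<noteq> n" using \<open>s m = s (Suc j)\<close> sne[of m] m by auto
    ultimately have "m = Suc j" using inj[of m "Suc j"] j(1) m by auto
    then show False using \<open>even m = even j\<close> by simp
  qed
  \<comment> \<open>Otherwise stepping back from both \<open>n\<close> and \<open>j\<close> uses the
    same involution and yields a repetition before \<open>n\<close>.\<close>
  have "j = 0"
  proof (rule ccontr)
    assume "j \<noteq> 0"
    then obtain k where k: "j = Suc k" by (cases j) auto
    then have "s m = s k" using sback[of m] sback[of k] parity j(2) m by auto
    then show False using dist[of k m] k j(1) m by auto
  qed
  then have n_even: "even n" and sn: "s n = e" using parity m j s0 by auto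
  define es where "es = map s [0..<n]"
  have "alternating_cycle G es"
    unfolding alternating_cycle_def
  proof (intro conjI allI impI)
    show "distinct es" using inj by (auto simp: es_def distinct_map inj_on_def)
    show "set es \<subseteq> parcs G" using sG by (auto simp: es_def)
    show "es \<noteq> []" "even (length es)" using n_even m by (auto simp: es_def)
    fix i assume "i < length es"
    then have i: "i < n" by (simp add: es_def)
    have "es ! ((i + 1) mod length es) = s (Suc i)"
      using i sn s0 by (cases "Suc i = n") (auto simp: es_def)
    then show "let e = es ! i; f = es ! ((i + 1) mod length es)
        in if even i then snd e = snd f else fst e = fst f"
      using i t[OF sG] h[OF sG] by (simp add: es_def sS Let_def)
  qed
  moreover have "es ! 0 = e" "0 < length es"
    using s0 m by (simp_all add: es_def del: upt_Suc)
  then have "e \<in> set es" by (metis nth_mem)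
  ultimately show ?thesis using that by (auto simp: ACs_def)
qed

text \<open>Around the cycle the vertices read \<open>c\<close>, \<open>x\<close>, \<open>a\<close>,
  \<open>y\<close>, \<open>b\<close>, \<open>z\<close>. Equal tails or equal heads would put three
  distinct arcs into a fibre of size two; a tail may still coincide with a head.\<close>

lemma six_arc_AC:
  assumes G: "two_digraph G" and "A \<in> ACs G" "card A = 6"
  obtains a b c x y z where "A = {(c, x), (a, x), (a, y), (b, y), (b, z), (c, z)}"
    "distinct [a, b, c]" "distinct [x, y, z]"
proof -
  obtain es where A: "A = set es" and ac: "alternating_cycle G es"
    using assms(2) by (auto simp: ACs_def)
  have es: "distinct es" "set es \<subseteq> parcs G"
    using ac by (auto simp: alternating_cycle_def)
  have "length es = 6" using assms(3) A es(1) distinct_card by metis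
  then obtain e0 e1 e2 e3 e4 e5 where l: "es = [e0, e1, e2, e3, e4, e5]"
    by (auto simp: numeral_eq_Suc length_Suc_conv)
  note nth = alternating_cycle_nth[OF ac, unfolded l, simplified]
  have eqs: "snd e0 = snd e1" "fst e1 = fst e2" "snd e2 = snd e3" "fst e3 = fst e4"
      "snd e4 = snd e5" "fst e5 = fst e0"
    using nth(1)[of 0] nth(2)[of 1] nth(1)[of 2] nth(2)[of 3] nth(1)[of 4] nth(2)[of 5] by auto
  have ne: "fst e1 \<noteq> fst e3" "fst e1 \<noteq> fst e5" "fst e3 \<noteq> fst e5"
      "snd e0 \<noteq> snd e2" "snd e0 \<noteq> snd e4" "snd e2 \<noteq> snd e4"
    using es l eqs partner_unique[OF G, of e1 e2 e3] partner_unique[OF G, of e1 e2 e5]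
      partner_unique[OF G, of e3 e4 e5] partner_unique[OF G, of e0 e1 e2]
      partner_unique[OF G, of e0 e1 e4] partner_unique[OF G, of e2 e3 e4] by auto
  show ?thesis
  proof (rule that)
    show "A = {(fst e5, snd e0), (fst e1, snd e0), (fst e1, snd e2), (fst e3, snd e2),
        (fst e3, snd e4), (fst e5, snd e4)}"
      using A l eqs by (metis list.set prod.collapse)
  qed (use ne in auto)
qed

section \<open>Switching a three-cycle\<close>

lemma funpow_eq_outside:
  assumes "\<forall>m < n. (f ^^ m) y \<notin> T" "\<forall>v. v \<notin> T \<longrightarrow> f v = g v"
  shows "(g ^^ n) y = (f ^^ n) y"
  using assms by (induction n) auto

text \<open>
  If the points of \<open>T\<close> lie in distinct orbits of \<open>f\<close>, the \<open>f\<close>-path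
  leaving \<open>t\<close> meets \<open>T\<close> again first in \<open>t\<close> itself, and
  \<open>g\<close> follows that path once it has entered it.
\<close>

lemma orbit_switch:
  assumes "permutation f" "t \<in> T" "\<forall>v. v \<notin> T \<longrightarrow> f v = g v" "g s = f t"
    and "\<forall>t' \<in> T. t' \<noteq> t \<longrightarrow> orbit f t' \<noteq> orbit f t"
  shows "t \<in> orbit g s"
proof -
  have self: "v \<in> orbit f v" for v using assms(1) by (rule permutation_self_in_orbit)
  obtain k where "0 < k" "(f ^^ k) t = t" using self[of t] by (auto simp: orbit_altdef)
  then have "(f ^^ (k - 1)) (f t) \<in> T"
    using assms(2) by (cases k) (auto simp: funpow_swap1)
  \<comment> \<open>The first visit to \<open>T\<close>, counted from \<open>f t\<close>; measured
    from \<open>t\<close> it takes \<open>Suc n\<close> steps.\<close>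
  define n where "n = (LEAST n. (f ^^ n) (f t) \<in> T)"
  have n: "(f ^^ n) (f t) \<in> T" unfolding n_def by (rule LeastI) fact
  have less: "\<forall>m < n. (f ^^ m) (f t) \<notin> T" unfolding n_def using not_less_Least by blast
  have "(f ^^ n) (f t) \<in> orbit f t"
    unfolding orbit_altdef by (auto intro!: exI[of _ "Suc n"] simp: funpow_swap1)
  then have "orbit f ((f ^^ n) (f t)) = orbit f t"
    by (rule orbit_cyclic_eq3[OF cyclic_on_orbit'[OF assms(1)]])
  then have "(f ^^ n) (f t) = t" using n assms(5) by blast
  then have "(g ^^ Suc n) s = t"
    using funpow_eq_outside[OF less assms(3)] assms(4) by (simp add: funpow_swap1 del: funpow.simps) (simp add: funpow_swap1)
  then show ?thesis unfolding orbit_altdef by (auto intro!: exI[of _ "Suc n"])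
qed

text \<open>\<open>g\<close> is \<open>f\<close> preceded by the three-cycle taking \<open>a\<close>
  to \<open>c\<close>, \<open>c\<close> to \<open>b\<close> and \<open>b\<close> to
  \<open>a\<close>. At most three orbits of \<open>f\<close> exist as each meets \<open>T\<close>,
  and oddness rules out two; three are merged by \<open>orbit_switch\<close>.\<close>

lemma three_cycle_switch:
  assumes f: "f permutes V" and g: "g permutes V" and "finite V"
    and T: "T = {a, b, c}" "distinct [a, b, c]" "T \<subseteq> V"
    and eq: "\<forall>v. v \<notin> T \<longrightarrow> f v = g v" "g a = f c" "g b = f a" "g c = f b"
    and meetf: "\<forall>v \<in> V. orbit f v \<inter> T \<noteq> {}" and meetg: "\<forall>v \<in> V. orbit g v \<inter> T \<noteq> {}"
    and odd: "odd (card (orbit f ` V))"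
  shows "(\<forall>v \<in> V. orbit f v = V) \<or> (\<forall>v \<in> V. orbit g v = V)"
proof -
  \<comment> \<open>An orbit meeting \<open>T\<close> is the orbit of \<open>a\<close>,
    \<open>b\<close> or \<open>c\<close>. The map \<open>h\<close> is kept general to serve both
    \<open>f\<close> and \<open>g\<close>.\<close>
  have single: "\<forall>v \<in> V. orbit h v = V"
    if h: "h permutes V" "\<forall>v \<in> V. orbit h v \<inter> T \<noteq> {}" "orbit h a = orbit h b" "orbit h a = orbit h c" for h
  proof -
    have per: "permutation h" using h(1) \<open>finite V\<close> by (auto simp: permutation_permutes)
    have "orbit h v = orbit h a" if v: "v \<in> V" for v
    proof -
      obtain t where "t \<in> orbit h v" "t \<in> T" using h(2) v by blast
      then show ?thesis
        using orbit_cyclic_eq3[OF cyclic_on_orbit'[OF per], of t v] h(3,4) T(1) by auto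
    qed
    moreover have "v \<in> orbit h v" for v using per by (rule permutation_self_in_orbit)
    moreover have "orbit h a \<subseteq> V" using permutes_orbit_subset[OF h(1)] T by auto
    ultimately show ?thesis by blast
  qed
  have perf: "permutation f" and perg: "permutation g"
    using f g \<open>finite V\<close> by (auto simp: permutation_permutes)
  have orbs: "orbit f ` V = {orbit f a, orbit f b, orbit f c}"
  proof
    show "orbit f ` V \<subseteq> {orbit f a, orbit f b, orbit f c}"
    proof (rule image_subsetI)
      fix v assume "v \<in> V"
      then obtain t where "t \<in> orbit f v" "t \<in> T" using meetf by blast
      then show "orbit f v \<in> {orbit f a, orbit f b, orbit f c}"
        using orbit_cyclic_eq3[OF cyclic_on_orbit'[OF perf], of t v] T(1) by auto
    qed
  qed (use T in auto)
  consider "orbit f a = orbit f b" "orbit f a = orbit f c"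
    | "distinct [orbit f a, orbit f b, orbit f c]"
  proof -
    have "card {A, B, C} = 2" if "\<not> (A = B \<and> A = C)" "\<not> distinct [A, B, C]" for A B C :: "'a set"
      using that by (cases "A = B"; cases "A = C"; cases "B = C") (simp_all add: card_insert_if)
    moreover have "card {orbit f a, orbit f b, orbit f c} \<noteq> 2"
      using odd unfolding orbs by (metis even_numeral)
    ultimately show thesis using that by blast
  qed
  then show ?thesis
  proof cases
    case 1 then show ?thesis using single[OF f meetf] by blast
  next
    case 2
    \<comment> \<open>Here \<open>orbit_switch\<close> links \<open>a\<close> to \<open>c\<close>
      through \<open>g a = f c\<close>; its second use links \<open>b\<close> to \<open>a\<close>
      through \<open>g b = f a\<close>.\<close>
    have "c \<in> orbit g a" by (rule orbit_switch[OF perf _ eq(1,2)]) (use 2 T(1) in auto)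
    then have "orbit g c = orbit g a" by (rule orbit_cyclic_eq3[OF cyclic_on_orbit'[OF perg]])
    moreover have "a \<in> orbit g b" by (rule orbit_switch[OF perf _ eq(1,3)]) (use 2 T(1) in auto)
    then have "orbit g a = orbit g b" by (rule orbit_cyclic_eq3[OF cyclic_on_orbit'[OF perg]])
    ultimately have "\<forall>v \<in> V. orbit g v = V" by (intro single[OF g meetg]) simp_all
    then show ?thesis by blast
  qed
qed

section \<open>Factors of two-dds\<close>

lemma two_dd_arcs:
  assumes "two_dd G"
  shows "fst ` parcs G = pverts G" "snd ` parcs G = pverts G"
proof -
  interpret pair_fin_digraph G using assms by (simp add: two_dd_def two_digraph_def)
  have "out_arcs (with_proj G) v \<noteq> {}" "in_arcs (with_proj G) v \<noteq> {}" if "v \<in> pverts G" for v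
    using assms that unfolding two_dd_def saturated_vertex_def out_degree_def in_degree_def
    by force+
  then have "\<exists>e \<in> parcs G. fst e = v" "\<exists>e \<in> parcs G. snd e = v" if "v \<in> pverts G" for v
    using that unfolding out_arcs_def in_arcs_def with_proj_simps by blast+
  then show "fst ` parcs G = pverts G" "snd ` parcs G = pverts G"
    using arc_fst_in_verts arc_snd_in_verts by blast+
qed

lemma hamiltonian_if_single_orbit:
  assumes "f permutes pverts G" "pverts G \<noteq> {}" "(\<lambda>v. (v, f v)) ` pverts G \<subseteq> parcs G"
    and "\<forall>v \<in> pverts G. orbit f v = pverts G"
  shows "hamiltonian G"
proof -
  obtain v where v: "v \<in> pverts G" using assms(2) by blast
  then obtain p where "pre_digraph.cycle (with_proj G) p" "set p = (\<lambda>u. (u, f u)) ` pverts G"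
    using orbit_cycle[of v f G] assms by auto
  then show ?thesis unfolding hamiltonian_def by force
qed

section \<open>Restricting a Hamiltonian cycle to a set of alternating cycles\<close>

lemma pair_wf_digraph_AC_subgraph: "pair_wf_digraph (AC_subgraph K)"
  by unfold_locales (auto simp: AC_subgraph_def)

text \<open>\<open>U\<close> consists of full fibres, so the arc of \<open>E\<close> over a point of
  the image of \<open>U\<close> already lies in \<open>U\<close>.\<close>

lemma bij_betw_Int_fibres:
  assumes "bij_betw h E (h ` P)" "E \<subseteq> P" "U \<subseteq> P"
    and fibre: "\<And>e e'. \<lbrakk>e \<in> U; e' \<in> P; h e' = h e\<rbrakk> \<Longrightarrow> e' \<in> U"
  shows "bij_betw h (E \<inter> U) (h ` U)"
proof -
  have "h e \<in> h ` (E \<inter> U)" if e: "e \<in> U" for e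
  proof -
    have "h e \<in> h ` E" using assms(1,3) e unfolding bij_betw_def by blast
    then obtain e' where e': "e' \<in> E" "h e' = h e" by (metis imageE)
    then have "e' \<in> E \<inter> U" using fibre[OF e, of e'] assms(2) by blast
    then show ?thesis using e'(2) by (metis imageI)
  qed
  moreover have "inj_on h (E \<inter> U)" using assms(1) by (auto simp: bij_betw_def inj_on_def)
  ultimately show ?thesis unfolding bij_betw_def by blast
qed

lemma closed_AC_set_imp_not_hamiltonian:
  assumes dd: "two_dd G" and K: "K \<subset> ACs G" "closed_AC_set K"
  shows "\<not> hamiltonian G"
proof
  assume "hamiltonian G"
  then obtain p where p: "pre_digraph.cycle (with_proj G) p" "\<forall>v \<in> pverts G. \<exists>e \<in> set p. fst e = v"
    by (auto simp: hamiltonian_def)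
  have G: "two_digraph G" using dd by (simp add: two_dd_def)
  interpret pair_fin_digraph G using G by (simp add: two_digraph_def)
  have pG: "set p \<subseteq> parcs G" and "distinct (map snd p)"
    using p(1) by (auto simp: cycle_with_proj_iff)
  then have inj_snd: "inj_on snd (set p)" by (simp add: distinct_map)
  have fst_p: "fst ` set p = pverts G"
    using p(2) pG arc_fst_in_verts by force
  \<comment> \<open>The heads are distinct and the tails cover \<open>pverts G\<close>. Counting
    shows that the heads cover it too, and then that the tails are distinct.\<close>
  have "snd ` set p \<subseteq> pverts G" using pG arc_snd_in_verts by blast
  moreover have "card (pverts G) \<le> card (snd ` set p)"
    using card_image_le[of "set p" fst] fst_p card_image[OF inj_snd] by simp
  ultimately have snd_p: "snd ` set p = pverts G"
    using pair_finite_verts by (intro card_seteq)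
  have "inj_on fst (set p)"
    using fst_p snd_p card_image[OF inj_snd] by (intro eq_card_imp_inj_on) auto
  then have b: "bij_betw fst (set p) (pverts G)" "bij_betw snd (set p) (pverts G)"
    using fst_p snd_p inj_snd by (auto simp: bij_betw_def)
  then obtain f where f: "f permutes pverts G" "set p = (\<lambda>v. (v, f v)) ` pverts G"
    by (rule bij_betw_permutes)
  define U where "U = \<Union>K"
  have U: "alternation_stable G U" unfolding U_def using AC_Union_stable[OF G] K(1) by blast
  define F where "F = \<lparr>pverts = pverts (AC_subgraph K), parcs = set p \<inter> U\<rparr>"
  note UG = alternation_stable_subset[OF U]
  have "bij_betw fst (set p \<inter> U) (fst ` U)"
    by (rule bij_betw_Int_fibres[OF b(1)[folded two_dd_arcs(1)[OF dd]] pG UG])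
      (erule (1) alternation_stableD[OF U], simp)
  moreover have "bij_betw snd (set p \<inter> U) (snd ` U)"
    by (rule bij_betw_Int_fibres[OF b(2)[folded two_dd_arcs(2)[OF dd]] pG UG])
      (erule (1) alternation_stableD[OF U], simp)
  ultimately have "is_factor (AC_subgraph K) F"
    unfolding is_factor_iff_bij_betw[OF pair_wf_digraph_AC_subgraph]
    by (simp add: F_def AC_subgraph_def U_def)
  then have "index F \<noteq> 0"
    using K(2) by (auto simp: closed_AC_set_def closed_digraph_def open_factor_def)
  then obtain q where q: "pre_digraph.cycle (with_proj F) q"
    unfolding index_def by fastforce
  have qp: "set q \<subseteq> set p \<inter> U" "q \<noteq> []"
    using q by (auto simp: cycle_with_proj_iff F_def)
  \<comment> \<open>Both \<open>p\<close> and \<open>q\<close> follow \<open>f\<close>, so their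
    tail sets are orbits of \<open>f\<close>; sharing an arc, they coincide.\<close>
  have "\<forall>e \<in> set p. snd e = f (fst e)" using f(2) by auto
  then have "cyclic_on f (fst ` set p)" "cyclic_on f (fst ` set q)"
    using cycle_cyclic_on[OF p(1), of f] cycle_cyclic_on[OF q, of f] qp(1) by auto
  moreover obtain e where "e \<in> set q" using qp(2) by (cases q) auto
  ultimately have "fst ` set q = fst ` set p"
    using orbit_cyclic_eq3[of f "fst ` set q" "fst e"] orbit_cyclic_eq3[of f "fst ` set p" "fst e"] qp(1)
    by blast
  moreover have "set q = set p" if "fst ` set q = fst ` set p"
    using that qp(1) f(2) by (force simp: image_iff)
  ultimately have pU: "set p \<subseteq> U" using qp by blast
  \<comment> \<open>By stability the arc of \<open>p\<close> leaving a tail of \<open>A\<close>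
    belongs to \<open>A\<close>, although all arcs of \<open>p\<close> lie in members of
    \<open>K\<close>.\<close>
  obtain A where A: "A \<in> ACs G" "A \<notin> K" using K(1) by blast
  then have "A \<noteq> {}" by (auto simp: ACs_def alternating_cycle_def)
  then obtain d where d: "d \<in> A" by blast
  have sat: "alternation_stable G A" by (rule AC_stable[OF G A(1)])
  then have "fst d \<in> pverts G" using d arc_fst_in_verts alternation_stable_subset by blast
  then obtain d' where d': "d' \<in> set p" "fst d' = fst d" using p(2) by blast
  then have "d' \<in> A" using alternation_stableD[OF sat d] pG by blast
  moreover obtain B where "B \<in> K" "d' \<in> B" using d'(1) pU by (auto simp: U_def)
  ultimately show False using AC_disjoint[OF G, of A B] A K(1) by blast
qed

section \<open>Completing an open factor by a matching inside one alternating cycle\<close>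

text \<open>Disjoint stable sets share no tail and no head, so the bijections on the two parts glue,
  even where a tail of one part is a head of the other.\<close>

lemma factor_insert_matching:
  assumes dd: "two_dd G" and U: "alternation_stable G U" and A: "alternation_stable G A"
    and cover: "U \<union> A = parcs G" "U \<inter> A = {}"
    and E: "E \<subseteq> U" "bij_betw fst E (fst ` U)" "bij_betw snd E (snd ` U)"
    and M: "M \<subseteq> A" "bij_betw fst M (fst ` A)" "bij_betw snd M (snd ` A)"
  obtains f where "f permutes pverts G" "E \<union> M = (\<lambda>v. (v, f v)) ` pverts G"
    "is_factor G \<lparr>pverts = pverts G, parcs = E \<union> M\<rparr>"
proof -
  interpret pair_fin_digraph G using dd by (simp add: two_dd_def two_digraph_def)
  have UA: "U \<subseteq> parcs G" "A \<subseteq> parcs G"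
    "\<And>e e'. \<lbrakk>e \<in> U; e' \<in> A\<rbrakk> \<Longrightarrow> fst e' \<noteq> fst e \<and> snd e' \<noteq> snd e"
    using U A cover(2) unfolding alternation_stable_def by blast+
  then have "fst ` U \<inter> fst ` A = {}" "snd ` U \<inter> snd ` A = {}" by fastforce+
  moreover have "fst ` U \<union> fst ` A = pverts G" "snd ` U \<union> snd ` A = pverts G"
    using two_dd_arcs[OF dd] cover(1) by (metis image_Un)+
  ultimately have b: "bij_betw fst (E \<union> M) (pverts G)" "bij_betw snd (E \<union> M) (pverts G)"
    using bij_betw_combine[OF E(2) M(2)] bij_betw_combine[OF E(3) M(3)] by auto
  then obtain f where f: "f permutes pverts G" "E \<union> M = (\<lambda>v. (v, f v)) ` pverts G"
    by (rule bij_betw_permutes)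
  moreover have "pair_wf_digraph G" by unfold_locales
  then have "is_factor G \<lparr>pverts = pverts G, parcs = E \<union> M\<rparr>"
    using is_factor_iff_bij_betw[of G] b two_dd_arcs[OF dd] UA E(1) M(1) by auto
  ultimately show ?thesis by (rule that)
qed

lemma open_AC_setE:
  assumes "\<not> closed_AC_set K" "finite (\<Union>K)"
  obtains E where "E \<subseteq> \<Union>K" "bij_betw fst E (fst ` \<Union>K)" "bij_betw snd E (snd ` \<Union>K)"
    "\<nexists>p. pre_digraph.cycle (with_proj \<lparr>pverts = pverts (AC_subgraph K), parcs = E\<rparr>) p"
proof -
  obtain F where F: "is_factor (AC_subgraph K) F" "index F = 0"
    using assms(1) by (auto simp: closed_AC_set_def closed_digraph_def open_factor_def)
  have F': "pverts F = pverts (AC_subgraph K)" "parcs F \<subseteq> \<Union>K"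
    "bij_betw fst (parcs F) (fst ` \<Union>K)" "bij_betw snd (parcs F) (snd ` \<Union>K)"
    using F(1) unfolding is_factor_iff_bij_betw[OF pair_wf_digraph_AC_subgraph]
    by (auto simp: AC_subgraph_def)
  \<comment> \<open>\<open>card\<close> is 0 on infinite sets, so finiteness is established before
    \<open>index F = 0\<close> is read as the absence of cycles.\<close>
  have "{set p | p. pre_digraph.cycle (with_proj F) p} \<subseteq> Pow (\<Union>K)"
    using F'(2) by (auto simp: cycle_with_proj_iff)
  then have "finite {set p | p. pre_digraph.cycle (with_proj F) p}"
    using assms(2) by (meson finite_Pow_iff finite_subset)
  then have "\<not> pre_digraph.cycle (with_proj F) p" for p
    using F(2) by (auto simp: index_def card_eq_0_iff)
  moreover have "\<lparr>pverts = pverts (AC_subgraph K), parcs = parcs F\<rparr> = F"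
    using F'(1) by simp
  ultimately show ?thesis by (intro that[OF F'(2-4)]) simp
qed

text \<open>An orbit avoiding the tails of \<open>M\<close> would use arcs of \<open>E\<close> alone
  and form a cycle inside \<open>E\<close>.\<close>

lemma orbit_meets_tails:
  assumes f: "f permutes V" "finite V" "E \<union> M = (\<lambda>v. (v, f v)) ` V"
    and acyclic: "\<nexists>p. pre_digraph.cycle (with_proj \<lparr>pverts = W, parcs = E\<rparr>) p"
    and "fst ` E \<subseteq> W" and v: "v \<in> V"
  shows "orbit f v \<inter> fst ` M \<noteq> {}"
proof
  assume disj: "orbit f v \<inter> fst ` M = {}"
  have self: "v \<in> orbit f v"
    using f by (intro permutation_self_in_orbit) (auto simp: permutation_permutes)
  have sub: "(\<lambda>u. (u, f u)) ` orbit f v \<subseteq> E"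
  proof (rule image_subsetI)
    fix u assume u: "u \<in> orbit f v"
    then have "(u, f u) \<in> E \<union> M" using permutes_orbit_subset[OF f(1) v] f(3) by auto
    moreover have "(u, f u) \<notin> M" using u disj by force
    ultimately show "(u, f u) \<in> E" by blast
  qed
  moreover have "v \<in> W" using sub self assms(5) by force
  ultimately show False
    using orbit_cycle[OF self, of "\<lparr>pverts = W, parcs = E\<rparr>"] acyclic by simp
qed

lemma all_open_imp_hamiltonian:
  assumes dd: "two_dd G" and six: "\<forall>A \<in> ACs G. card A = 6" and odd: "odd_digraph G"
    and "open": "\<And>K. \<lbrakk>K \<noteq> {}; K \<subset> ACs G\<rbrakk> \<Longrightarrow> \<not> closed_AC_set K"
  shows "hamiltonian G"
proof -
  have G: "two_digraph G" using dd by (simp add: two_dd_def)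
  interpret pair_fin_digraph G using G by (simp add: two_digraph_def)
  have wf: "pair_wf_digraph G" by unfold_locales
  \<comment> \<open>Without arcs, \<open>G\<close> would be a factor of itself with index 0, which
    is not odd.\<close>
  have "parcs G \<noteq> {}"
  proof
    assume e: "parcs G = {}"
    then have "is_factor G G" by (simp add: is_factor_iff_bij_betw[OF wf] bij_betw_def)
    moreover have "index G = 0" using e by (simp add: index_def cycle_with_proj_iff)
    ultimately show False using odd by (auto simp: odd_digraph_def)
  qed
  then obtain A where A: "A \<in> ACs G" using AC_cover[OF G] by blast
  define K where "K = ACs G - {A}"
  define U where "U = \<Union>K"
  have stA: "alternation_stable G A" by (rule AC_stable[OF G A])
  have stU: "alternation_stable G U"
    unfolding U_def by (rule AC_Union_stable[OF G]) (auto simp: K_def)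
  have disj: "U \<inter> A = {}" using AC_disjoint[OF G A] by (auto simp: U_def K_def)
  have cover: "U \<union> A = parcs G"
  proof
    show "U \<union> A \<subseteq> parcs G" using alternation_stable_subset stU stA by blast
    show "parcs G \<subseteq> U \<union> A"
    proof
      fix e assume "e \<in> parcs G"
      then obtain B where "B \<in> ACs G" "e \<in> B" by (rule AC_cover[OF G])
      then show "e \<in> U \<union> A" unfolding U_def K_def by blast
    qed
  qed
  \<comment> \<open>If \<open>A\<close> is the only alternating cycle, \<open>K\<close> is empty and
    the openness hypothesis says nothing; the empty arc set then serves as \<open>E\<close>.\<close>
  obtain E where E: "E \<subseteq> U" "bij_betw fst E (fst ` U)" "bij_betw snd E (snd ` U)"
    and acyclic: "\<nexists>p. pre_digraph.cycle (with_proj \<lparr>pverts = pverts (AC_subgraph K), parcs = E\<rparr>) p"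
  proof (cases "K = {}")
    case True
    then show ?thesis by (intro that[of "{}"]) (auto simp: U_def cycle_with_proj_iff bij_betw_def)
  next
    case False
    then have "\<not> closed_AC_set K" using "open"[of K] A by (auto simp: K_def)
    moreover have "finite (\<Union>K)"
      by (rule finite_subset[OF _ pair_finite_arcs]) (use cover in \<open>auto simp: U_def\<close>)
    ultimately obtain E where "E \<subseteq> U" "bij_betw fst E (fst ` U)" "bij_betw snd E (snd ` U)"
      "\<nexists>p. pre_digraph.cycle (with_proj \<lparr>pverts = pverts (AC_subgraph K), parcs = E\<rparr>) p"
      unfolding U_def by (rule open_AC_setE)
    then show ?thesis by (rule that)
  qed
  have fstE: "fst ` E \<subseteq> pverts (AC_subgraph K)"
    using E(1) by (auto simp: AC_subgraph_def U_def)
  obtain a b c x y z where A_eq: "A = {(c, x), (a, x), (a, y), (b, y), (b, z), (c, z)}"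
    and abc: "distinct [a, b, c]" and xyz: "distinct [x, y, z]"
    by (rule six_arc_AC[OF G A bspec[OF six A]])
  \<comment> \<open>Every second arc of the six-cycle: the two perfect matchings between its tails
    and its heads.\<close>
  define M where "M = {(c, x), (a, y), (b, z)}"
  define N where "N = {(a, x), (b, y), (c, z)}"
  have M: "M \<subseteq> A" "bij_betw fst M (fst ` A)" "bij_betw snd M (snd ` A)"
    using abc xyz by (auto simp: M_def A_eq bij_betw_def)
  have N: "N \<subseteq> A" "bij_betw fst N (fst ` A)" "bij_betw snd N (snd ` A)"
    using abc xyz by (auto simp: N_def A_eq bij_betw_def)
  obtain f where f: "f permutes pverts G" "E \<union> M = (\<lambda>v. (v, f v)) ` pverts G"
    and factor: "is_factor G \<lparr>pverts = pverts G, parcs = E \<union> M\<rparr>"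
    by (rule factor_insert_matching[OF dd stU stA cover disj E M])
  obtain g where g: "g permutes pverts G" "E \<union> N = (\<lambda>v. (v, g v)) ` pverts G"
    by (rule factor_insert_matching[OF dd stU stA cover disj E N])
  define T where "T = {a, b, c}"
  have T_M: "T = fst ` M" and T_N: "T = fst ` N" by (auto simp: T_def M_def N_def)
  have f_arc: "f u = w" if "(u, w) \<in> E \<union> M" for u w using that unfolding f(2) by auto
  have g_arc: "g u = w" if "(u, w) \<in> E \<union> N" for u w using that unfolding g(2) by auto
  have f_abc: "f a = y" "f b = z" "f c = x" by (auto intro!: f_arc simp: M_def)
  have g_abc: "g a = x" "g b = y" "g c = z" by (auto intro!: g_arc simp: N_def)
  \<comment> \<open>Outside \<open>T\<close> the outgoing arc comes from \<open>E\<close>, which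
    both factors share.\<close>
  have eq: "f v = g v" if "v \<notin> T" for v
  proof (cases "v \<in> pverts G")
    case True
    then have "(v, f v) \<in> E \<union> M" by (simp add: f(2))
    moreover have "(v, f v) \<notin> M" using that T_M by force
    ultimately show ?thesis using g_arc[of v "f v"] by simp
  next
    case False
    then show ?thesis using f(1) g(1) by (simp add: permutes_not_in)
  qed
  have TV: "T \<subseteq> pverts G"
    unfolding T_M using M(1) alternation_stable_subset[OF stA] arc_fst_in_verts by blast
  have "odd (card (orbit f ` pverts G))"
    using odd factor index_functional[of f "\<lparr>pverts = pverts G, parcs = E \<union> M\<rparr>"] f pair_finite_verts
    by (auto simp: odd_digraph_def)
  moreover have "\<forall>v \<in> pverts G. orbit f v \<inter> T \<noteq> {}"
    unfolding T_M using orbit_meets_tails[OF f(1) pair_finite_verts f(2) acyclic fstE] by blast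
  moreover have "\<forall>v \<in> pverts G. orbit g v \<inter> T \<noteq> {}"
    unfolding T_N using orbit_meets_tails[OF g(1) pair_finite_verts g(2) acyclic fstE] by blast
  ultimately have "(\<forall>v \<in> pverts G. orbit f v = pverts G) \<or> (\<forall>v \<in> pverts G. orbit g v = pverts G)"
    using three_cycle_switch[OF f(1) g(1) pair_finite_verts T_def abc TV] eq f_abc g_abc by simp
  moreover have "E \<union> M \<subseteq> parcs G" "E \<union> N \<subseteq> parcs G" using E(1) M(1) N(1) cover by auto
  moreover have "pverts G \<noteq> {}" using TV by (auto simp: T_def)
  ultimately show ?thesis
    using hamiltonian_if_single_orbit f g by metis
qed

theorem theorem5:
  fixes G :: "'a pair_pre_digraph"
  assumes "two_dd G"
    and "\<forall>A \<in> ACs G. card A = 6"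
    and "odd_digraph G"
  shows "\<not> hamiltonian G \<longleftrightarrow> (\<exists>K. K \<noteq> {} \<and> K \<subset> ACs G \<and> closed_AC_set K)"
  using all_open_imp_hamiltonian[OF assms] closed_AC_set_imp_not_hamiltonian[OF assms(1)] by blast

end
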